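(* Let $\alpha=\beta>0$. If $z_0\in\mathbb{R}$ is a mode of the density $f_{\alpha,\alpha}$, then $-z_0$ is also a mode of $f_{\alpha,\alpha}$.
   Context: $\Phi$ and $\phi$ denote the standard normal cumulative distribution function and density, and $\mathrm{B}(\cdot,\cdot)$ is the beta function. For $\alpha,\beta>0$ the (standardized) beta normal density is $$f_{\alpha,\beta}(z)=\frac{1}{\mathrm{B}(\alpha,\beta)}\,\Phi(z)^{\alpha-1}\,[1-\Phi(z)]^{\beta-1}\,\phi(z),\qquad z\in\mathbb{R}.$$ A mode (modal point) of $f_{\alpha,\beta}$ is a critical point $z$ (that is, $f_{\alpha,\beta}'(z)=0$) at which the second derivative is non-positive, $f_{\alpha,\beta}''(z)\le 0$. *)

theory Defs
  imports "HOL-Probability.Probability"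
begin

definition std_normal_cdf :: "real \<Rightarrow> real" where
  "std_normal_cdf = cdf std_normal_distribution"

definition beta_normal_density :: "real \<Rightarrow> real \<Rightarrow> real \<Rightarrow> real" where
  "beta_normal_density \<alpha> \<beta> z =
     1 / Beta \<alpha> \<beta> * std_normal_cdf z powr (\<alpha> - 1) * (1 - std_normal_cdf z) powr (\<beta> - 1)
       * std_normal_density z"

(* The existence of both derivatives is part of the definition, because deriv is an
   arbitrary value at points of non-differentiability. *)
definition is_mode :: "(real \<Rightarrow> real) \<Rightarrow> real \<Rightarrow> bool" where
  "is_mode f z \<longleftrightarrow>
     (\<forall>\<^sub>F x in nhds z. f differentiable at x) \<and> deriv f differentiable at z \<and>
     deriv f z = 0 \<and> deriv (deriv f) z \<le> 0"

end

theory Submission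
  imports Defs
begin

text \<open>
  The normal density is even, so reflecting the line turns \<open>\<Phi>\<close> into its complement:
  \<open>\<Phi> (- z) = 1 - \<Phi> z\<close>.  For equal shape parameters the density is therefore symmetric under
  exchanging \<open>\<Phi>\<close> and \<open>1 - \<Phi>\<close>, hence an even function.  The first derivative of an even
  function is odd and its second derivative is even, so the reflection of a critical point is a
  critical point with the same second derivative.  The two halves of this argument are
  \<open>std_normal_cdf_uminus\<close> and \<open>is_mode_uminus_of_even\<close>.
\<close>

text \<open>
  Reflection maps \<open>{..- x}\<close> to \<open>{x..}\<close>, which is the complement of \<open>{..x}\<close> up to the single
  point \<open>x\<close>, and a point has no mass under a distribution with a density.
\<close>
lemma std_normal_cdf_uminus: "std_normal_cdf (- x) = 1 - std_normal_cdf x"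
proof -
  interpret M: real_distribution std_normal_distribution
    by (rule real_dist_normal_dist)
  have "emeasure std_normal_distribution {..- x}
      = (\<integral>\<^sup>+ y. ennreal (std_normal_density y) * indicator {..- x} y \<partial>lborel)"
    by (simp add: emeasure_density)
  also have "\<dots> = (\<integral>\<^sup>+ y. ennreal (std_normal_density (- y)) * indicator {..- x} (- y) \<partial>lborel)"
    by (subst nn_integral_real_affine[where c = "-1" and t = 0]) simp_all
  also have "\<dots> = (\<integral>\<^sup>+ y. ennreal (std_normal_density y) * indicator {x<..} y \<partial>lborel)"
  proof (rule nn_integral_cong_AE)
    show "AE y in lborel. ennreal (std_normal_density (- y)) * indicator {..- x} (- y)
        = ennreal (std_normal_density y) * indicator {x<..} y"
      using AE_lborel_singleton[of x]
      by eventually_elim (auto simp: normal_density_def split: split_indicator)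
  qed
  also have "\<dots> = emeasure std_normal_distribution {x<..}"
    by (simp add: emeasure_density)
  finally have "measure std_normal_distribution {..- x} = measure std_normal_distribution {x<..}"
    by (simp add: measure_def)
  also have "{x<..} = space std_normal_distribution - {..x}"
    by auto
  also have "measure std_normal_distribution \<dots> = 1 - measure std_normal_distribution {..x}"
    by (rule M.prob_compl) simp
  finally show ?thesis
    by (simp add: std_normal_cdf_def cdf_def)
qed

lemma beta_normal_density_uminus:
  "beta_normal_density \<alpha> \<alpha> (- z) = beta_normal_density \<alpha> \<alpha> z"
  by (simp add: beta_normal_density_def std_normal_cdf_uminus normal_density_def)

lemma has_derivative_uminus_of_even:
  fixes f :: "real \<Rightarrow> real"
  assumes even: "\<And>x. f (- x) = f x"
    and "(f has_real_derivative D) (at x)"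
  shows "(f has_real_derivative - D) (at (- x))"
  using assms(2) by (simp add: DERIV_mirror even)

lemma is_mode_uminus_of_even:
  assumes even: "\<And>x. f (- x) = f x" and mode: "is_mode f z"
  shows "is_mode f (- z)"
proof -
  have diff: "f differentiable at (- x)" "deriv f (- x) = - deriv f x"
    if "f differentiable at x" for x
  proof -
    have "(f has_real_derivative deriv f x) (at x)"
      using that by (simp add: DERIV_deriv_iff_real_differentiable)
    then have *: "(f has_real_derivative - deriv f x) (at (- x))"
      by (rule has_derivative_uminus_of_even[of f, OF even])
    then show "f differentiable at (- x)" "deriv f (- x) = - deriv f x"
      by (auto simp: DERIV_imp_deriv real_differentiable_def)
  qed
  have near: "\<forall>\<^sub>F x in nhds z. f differentiable at x"
    and critical: "deriv f z = 0"
    using mode by (auto simp: is_mode_def)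
  have near': "\<forall>\<^sub>F x in nhds (- z). f differentiable at x"
  proof -
    have "filterlim uminus (nhds z) (nhds (- z))"
      using tendsto_minus[OF filterlim_ident, of "- z"] by simp
    from eventually_compose_filterlim[OF near this] show ?thesis
      by eventually_elim (use diff(1) in fastforce)
  qed
  \<comment> \<open>The derivative is known to be odd only where it exists, hence an equation near the point.\<close>
  have odd: "\<forall>\<^sub>F x in nhds (- z). deriv f x = - deriv f (- x)"
    using near' by eventually_elim (simp add: diff(2))
  have "(deriv f has_real_derivative deriv (deriv f) z) (at z)"
    using mode by (simp add: is_mode_def DERIV_deriv_iff_real_differentiable)
  then have "((\<lambda>x. deriv f (- x)) has_real_derivative - deriv (deriv f) z) (at (- z))"
    using DERIV_mirror[of "deriv f" "deriv (deriv f) z" "- z"] by simp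
  then have "((\<lambda>x. - deriv f (- x)) has_real_derivative deriv (deriv f) z) (at (- z))"
    using DERIV_minus by fastforce
  then have second: "(deriv f has_real_derivative deriv (deriv f) z) (at (- z))"
    using DERIV_cong_ev[OF refl odd refl] by simp
  have "deriv f (- z) = 0"
    using diff(2)[OF eventually_nhds_x_imp_x[OF near]] critical by simp
  moreover have "deriv (deriv f) (- z) \<le> 0"
    using DERIV_imp_deriv[OF second] mode by (simp add: is_mode_def)
  moreover have "deriv f differentiable at (- z)"
    using second by (auto simp: real_differentiable_def)
  ultimately show ?thesis
    using near' by (simp add: is_mode_def)
qed

theorem proposition2:
  fixes \<alpha> z\<^sub>0 :: real
  assumes "\<alpha> > 0"
    and "is_mode (beta_normal_density \<alpha> \<alpha>) z\<^sub>0"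
  shows "is_mode (beta_normal_density \<alpha> \<alpha>) (- z\<^sub>0)"
  by (rule is_mode_uminus_of_even[OF beta_normal_density_uminus assms(2)])

end
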